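(* Let $m>0$ and $n\ge0$ be integers and let $x_1,\ldots,x_m,y_1,\ldots,y_m$ be real numbers. The following are equivalent: (i) $(x_1,\ldots,x_m,y_1,\ldots,y_m)\in\mathbb{Q}^{2m}$ is a solution of the system $\sum_{i=1}^mx_iy_i^k=a_k$, $k=0,1,\ldots,n$; (ii) the formula \[ \frac{1}{\sqrt{\pi}}\int_{-\infty}^{\infty}f(t)\,e^{-t^2}dt=\sum_{i=1}^mx_if(y_i) \] is a rational quadrature of degree $n$.
   Context: Here $a_k=\frac{1}{\sqrt{\pi}}\int_{-\infty}^{\infty}t^ke^{-t^2}\,dt$ for $k\ge 0$; convention $y^0=1$. The formula in (ii) is a quadrature formula of degree $n$ if it holds for all polynomials $f$ of degree at most $n$; it is a rational quadrature if moreover all nodes $y_i$ and weights $x_i$ are rational. *)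

theory Defs
  imports "HOL-Analysis.Analysis" "HOL-Computational_Algebra.Polynomial"
begin

definition gaussian_moment :: "nat \<Rightarrow> real" where
  "gaussian_moment k = 1 / sqrt pi * (LBINT t. t ^ k * exp (- (t ^ 2)))"

(* Weights x 1, ..., x m and nodes y 1, ..., y m; values outside {1..m} are irrelevant.
   The nodes need not be distinct and the weights may have any sign. *)
definition gaussian_quadrature ::
    "nat \<Rightarrow> nat \<Rightarrow> (nat \<Rightarrow> real) \<Rightarrow> (nat \<Rightarrow> real) \<Rightarrow> bool" where
  "gaussian_quadrature n m x y \<longleftrightarrow>
     (\<forall>f :: real poly. degree f \<le> n \<longrightarrow>
        1 / sqrt pi * (LBINT t. poly f t * exp (- (t ^ 2))) = (\<Sum>i = 1..m. x i * poly f (y i)))"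

definition rational_gaussian_quadrature ::
    "nat \<Rightarrow> nat \<Rightarrow> (nat \<Rightarrow> real) \<Rightarrow> (nat \<Rightarrow> real) \<Rightarrow> bool" where
  "rational_gaussian_quadrature n m x y \<longleftrightarrow>
     gaussian_quadrature n m x y \<and> (\<forall>i \<in> {1..m}. x i \<in> \<rat> \<and> y i \<in> \<rat>)"

end

theory Submission
  imports Defs "HOL-Probability.Distributions"
begin

text \<open>
  Both sides of the quadrature formula are linear in the polynomial \<open>f\<close>, so the formula holds in
  degree at most \<open>n\<close> as soon as it holds on the monomial basis \<open>1, t, \<dots>, t ^ n\<close>; and on \<open>t ^ k\<close>
  it reads exactly as the \<open>k\<close>-th moment equation. The only analytic input is that the integral
  is additive over monomials, that is, that every \<open>t ^ k * exp (- t\<^sup>2)\<close> is integrable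
  (\<open>gaussian_monomial_integrable\<close>). This yields \<open>gaussian_integral_poly\<close>, which expresses the
  integral of a polynomial through the moments. Rationality of the nodes and weights is the same
  condition on both sides.
\<close>

text \<open>
  The integrand is an even or an odd function according to the parity of \<open>k\<close>, so reflection
  reduces the claim to the half-line, where the moments are known in closed form.
\<close>

lemma gaussian_monomial_integrable:
  "integrable lborel (\<lambda>t::real. t ^ k * exp (- (t ^ 2)))"
proof (cases "even k")
  case True
  then obtain j where "k = 2 * j" by (elim evenE)
  then show ?thesis
    using has_bochner_integral_even_function[OF gaussian_moment_even_pos[of j]]
    by (auto simp: mult.commute has_bochner_integral_iff)
next
  case False
  then obtain j where "k = 2 * j + 1" by (elim oddE)
  then show ?thesis
    using has_bochner_integral_odd_function[OF gaussian_moment_odd_pos[of j]]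
    by (auto simp: mult.commute has_bochner_integral_iff)
qed

lemma gaussian_integral_poly:
  "1 / sqrt pi * (LBINT t. poly f t * exp (- (t ^ 2)))
     = (\<Sum>k\<le>degree f. coeff f k * gaussian_moment k)"
proof -
  have "(LBINT t. poly f t * exp (- (t ^ 2)))
      = (LBINT t. \<Sum>k\<le>degree f. coeff f k * (t ^ k * exp (- (t ^ 2))))"
    by (simp add: poly_altdef sum_distrib_right mult.assoc)
  also have "\<dots> = (\<Sum>k\<le>degree f. coeff f k * (LBINT t. t ^ k * exp (- (t ^ 2))))"
    by (subst Bochner_Integration.integral_sum) (auto intro: gaussian_monomial_integrable)
  finally show ?thesis
    by (simp add: gaussian_moment_def sum_divide_distrib)
qed

lemma weighted_sum_poly:
  fixes x y :: "'b \<Rightarrow> 'a::comm_semiring_1"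
  shows "(\<Sum>i\<in>I. x i * poly f (y i)) = (\<Sum>k\<le>degree f. coeff f k * (\<Sum>i\<in>I. x i * y i ^ k))"
  by (simp add: poly_altdef sum_distrib_left mult.left_commute, subst sum.swap, simp)

lemma gaussian_quadrature_iff_moments:
  "gaussian_quadrature n m x y \<longleftrightarrow> (\<forall>k\<le>n. (\<Sum>i = 1..m. x i * y i ^ k) = gaussian_moment k)"
proof
  assume quad: "gaussian_quadrature n m x y"
  show "\<forall>k\<le>n. (\<Sum>i = 1..m. x i * y i ^ k) = gaussian_moment k"
  proof (intro allI impI)
    fix k assume "k \<le> n"
    then have "degree (monom (1::real) k) \<le> n" by (simp add: degree_monom_eq)
    with quad show "(\<Sum>i = 1..m. x i * y i ^ k) = gaussian_moment k"
      unfolding gaussian_quadrature_def gaussian_moment_def by (metis (no_types, lifting)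
          poly_monom mult_1 sum.cong Bochner_Integration.integral_cong)
  qed
next
  assume "\<forall>k\<le>n. (\<Sum>i = 1..m. x i * y i ^ k) = gaussian_moment k"
  then show "gaussian_quadrature n m x y"
    unfolding gaussian_quadrature_def gaussian_integral_poly weighted_sum_poly by simp
qed

theorem proposition5p2:
  fixes m n :: nat and x y :: "nat \<Rightarrow> real"
  assumes "m > 0"
  shows "((\<forall>i \<in> {1..m}. x i \<in> \<rat> \<and> y i \<in> \<rat>) \<and>
          (\<forall>k \<in> {0..n}. (\<Sum>i = 1..m. x i * y i ^ k) = gaussian_moment k))
     \<longleftrightarrow> rational_gaussian_quadrature n m x y"
  unfolding rational_gaussian_quadrature_def gaussian_quadrature_iff_moments by auto

end
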